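(* Let $s\ge1$ be an integer, let $p,q\in(0,1)$ satisfy $\sum_{k=0}^{s}p^kq^{s-k}=1$, and let $X\sim\mathcal{B}^{(s)}(p)$ follow the $s$-Bernoulli distribution. Then the probability generating function $G_X(t)=E(t^X)$ satisfies, if $p\neq q$, $$G_X(t)=\sum_{k=0}^{s}t^kp^kq^{s-k}=\frac{(pt)^{s+1}-q^{s+1}}{pt-q}\qquad\text{for all real } t \text{ with } pt\neq q,$$ and, if $p=q$, $$G_X(t)=\frac{1}{s+1}\left(\frac{1-t^{s+1}}{1-t}\right)\qquad\text{for all real } t\ne1.$$
   Context: The $s$-Bernoulli distribution $\mathcal{B}^{(s)}(p)$, where $p,q\in(0,1)$ satisfy $\sum_{k=0}^s p^kq^{s-k}=1$, is the law on $\{0,1,\dots,s\}$ with $\mathbb{P}(X=k)=p^kq^{s-k}$. *)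

theory Defs
  imports "HOL-Probability.Probability"
begin

text \<open>
  The law with mass \<open>p ^ k * q ^ (s - k)\<close> at each \<open>k \<in> {0..s}\<close>. The parameter \<open>q\<close>, which the
  notation \<open>B^(s)(p)\<close> leaves implicit, is an argument here. The constant is meaningful only if
  these masses are nonnegative and sum to one, see \<open>pmf_s_bernoulli\<close>.
\<close>

definition s_bernoulli_pmf :: "nat \<Rightarrow> real \<Rightarrow> real \<Rightarrow> nat pmf" where
  "s_bernoulli_pmf s p q = embed_pmf (\<lambda>k. if k \<le> s then p ^ k * q ^ (s - k) else 0)"

lemma pmf_s_bernoulli:
  assumes "p \<in> {0<..<1}" "q \<in> {0<..<1}" and sum1: "(\<Sum>k=0..s. p ^ k * q ^ (s - k)) = 1"
  shows "pmf (s_bernoulli_pmf s p q) k = (if k \<le> s then p ^ k * q ^ (s - k) else 0)"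
  unfolding s_bernoulli_pmf_def
proof (rule pmf_embed_pmf)
  show "0 \<le> (if k \<le> s then p ^ k * q ^ (s - k) else 0)" for k
    using assms by auto
  have "(\<integral>\<^sup>+k. ennreal (if k \<le> s then p ^ k * q ^ (s - k) else 0) \<partial>count_space UNIV)
      = (\<Sum>k\<in>{0..s}. ennreal (if k \<le> s then p ^ k * q ^ (s - k) else 0))"
    by (rule nn_integral_count_space') auto
  also have "\<dots> = (\<Sum>k\<in>{0..s}. ennreal (p ^ k * q ^ (s - k)))"
    by (intro sum.cong) auto
  also have "\<dots> = ennreal (\<Sum>k=0..s. p ^ k * q ^ (s - k))"
    using assms by (intro sum_ennreal) auto
  also have "\<dots> = 1"
    using sum1 by simp
  finally show "(\<integral>\<^sup>+k. ennreal (if k \<le> s then p ^ k * q ^ (s - k) else 0) \<partial>count_space UNIV) = 1" .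
qed

definition prob_gen_fun :: "'a measure \<Rightarrow> ('a \<Rightarrow> nat) \<Rightarrow> real \<Rightarrow> real" where
  "prob_gen_fun M X t = (\<integral>\<omega>. t ^ X \<omega> \<partial>M)"

end

theory Submission
  imports Defs
begin

text \<open>The law of \<open>X\<close> has finite support, so for every real \<open>t\<close> the
  expectation of \<open>t ^ X\<close> is a finite sum, with terms
  \<open>(p * t) ^ k * q ^ (s - k)\<close> (\<open>prob_gen_fun_eq_integral_distr\<close>,
  \<open>integral_s_bernoulli_pmf\<close>). This is a homogeneous geometric sum, which
  \<open>sum_power_mult_power_eq\<close> closes when \<open>p * t \<noteq> q\<close>. If
  \<open>p = q\<close>, all \<open>s + 1\<close> masses equal \<open>p ^ s\<close>, so
  \<open>X\<close> is uniform and an ordinary geometric sum remains.\<close>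

text \<open>Factor \<open>x - y\<close> out of the difference of powers and divide. It is used with
  \<open>p * t\<close> and \<open>q\<close>, and with \<open>t\<close> and \<open>1\<close>.\<close>

lemma sum_power_mult_power_eq:
  fixes x y :: real
  assumes "x \<noteq> y"
  shows "(\<Sum>k=0..n. x ^ k * y ^ (n - k)) = (x ^ (n + 1) - y ^ (n + 1)) / (x - y)"
  using assms diff_power_eq_sum[of x n y]
  by (simp add: atLeast0AtMost lessThan_Suc_atMost field_simps del: power_Suc)

text \<open>Change of variables: only the law of \<open>X\<close> matters.\<close>

lemma prob_gen_fun_eq_integral_distr:
  assumes "X \<in> measurable M (count_space UNIV)"
  shows "prob_gen_fun M X t = (\<integral>k. t ^ k \<partial>distr M (count_space UNIV) X)"
  unfolding prob_gen_fun_def using assms by (subst integral_distr) auto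

text \<open>The support lies in \<open>{0..s}\<close>, so the integral is a finite sum and any
  \<open>f\<close> is allowed.\<close>

lemma integral_s_bernoulli_pmf:
  fixes f :: "nat \<Rightarrow> real"
  assumes "p \<in> {0<..<1}" "q \<in> {0<..<1}" "(\<Sum>k=0..s. p ^ k * q ^ (s - k)) = 1"
  shows "measure_pmf.expectation (s_bernoulli_pmf s p q) f
    = (\<Sum>k=0..s. f k * (p ^ k * q ^ (s - k)))"
proof -
  have "measure_pmf.expectation (s_bernoulli_pmf s p q) f
      = (\<Sum>k=0..s. f k * pmf (s_bernoulli_pmf s p q) k)"
    by (rule integral_measure_pmf_real)
      (auto simp: set_pmf_iff pmf_s_bernoulli[OF assms] split: if_splits)
  then show ?thesis
    by (simp add: pmf_s_bernoulli[OF assms])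
qed

theorem theorem3p1:
  fixes s :: nat and p q :: real and M :: "'a measure" and X :: "'a \<Rightarrow> nat"
  assumes "1 \<le> s"
    and "p \<in> {0<..<1}" and "q \<in> {0<..<1}"
    and "(\<Sum>k=0..s. p ^ k * q ^ (s - k)) = 1"
    and "prob_space M"
    and "X \<in> measurable M (count_space UNIV)"
    and "distr M (count_space UNIV) X = measure_pmf (s_bernoulli_pmf s p q)"
  shows "(p \<noteq> q \<longrightarrow> (\<forall>t::real. p * t \<noteq> q \<longrightarrow>
            prob_gen_fun M X t = (\<Sum>k=0..s. t ^ k * p ^ k * q ^ (s - k)) \<and>
            (\<Sum>k=0..s. t ^ k * p ^ k * q ^ (s - k))
              = ((p * t) ^ (s + 1) - q ^ (s + 1)) / (p * t - q))) \<and>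
         (p = q \<longrightarrow> (\<forall>t::real. t \<noteq> 1 \<longrightarrow>
            prob_gen_fun M X t = 1 / (real s + 1) * ((1 - t ^ (s + 1)) / (1 - t))))"
proof (intro conjI impI allI)
  \<comment> \<open>Valid for all \<open>t\<close>, with no case distinction, so it serves both
    \<open>p \<noteq> q\<close> and \<open>p = q\<close>.\<close>
  have pgf: "prob_gen_fun M X t = (\<Sum>k=0..s. t ^ k * p ^ k * q ^ (s - k))" for t
    using prob_gen_fun_eq_integral_distr[OF assms(6)] integral_s_bernoulli_pmf[OF assms(2-4)]
    by (simp add: assms(7) mult.assoc)
  then show "prob_gen_fun M X t = (\<Sum>k=0..s. t ^ k * p ^ k * q ^ (s - k))" for t .
  show "(\<Sum>k=0..s. t ^ k * p ^ k * q ^ (s - k))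
      = ((p * t) ^ (s + 1) - q ^ (s + 1)) / (p * t - q)" if "p * t \<noteq> q" for t
    using sum_power_mult_power_eq[OF that, of s] by (simp add: power_mult_distrib mult_ac)
  show "prob_gen_fun M X t = 1 / (real s + 1) * ((1 - t ^ (s + 1)) / (1 - t))"
    if "p = q" and "t \<noteq> 1" for t
  proof -
    \<comment> \<open>The exponents add up to \<open>s\<close> because \<open>k \<le> s\<close>;
      subtraction on naturals is truncated.\<close>
    have const: "p ^ k * q ^ (s - k) = p ^ s" if "k \<in> {0..s}" for k
      using that \<open>p = q\<close> by (simp flip: power_add)
    \<comment> \<open>The normalisation hypothesis now adds \<open>s + 1\<close> equal
      masses.\<close>
    then have "(real s + 1) * p ^ s = 1"
      using assms(4) by (simp add: add.commute)
    then have mass: "p ^ s = 1 / (real s + 1)"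
      by (simp add: field_simps)
    have "prob_gen_fun M X t = (\<Sum>k=0..s. t ^ k * p ^ s)"
      unfolding pgf mult.assoc by (intro sum.cong refl) (simp only: const)
    also have "\<dots> = p ^ s * (\<Sum>k=0..s. t ^ k)"
      by (simp add: sum_distrib_left mult.commute)
    \<comment> \<open>The case \<open>y = 1\<close>, with the signs of numerator and denominator
      both reversed.\<close>
    also have "(\<Sum>k=0..s. t ^ k) = (1 - t ^ (s + 1)) / (1 - t)"
      using sum_power_mult_power_eq[OF \<open>t \<noteq> 1\<close>, of s] \<open>t \<noteq> 1\<close>
      by (simp add: divide_simps) (simp add: algebra_simps)
    finally show ?thesis
      by (simp only: mass)
  qed
qed

end
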